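(* Fix $n\geq2$. Let $\mathfrak{m}$ be a convex $n$-dimensional polytope in $\mathbb{R}^n$ with vertex set $\{\mathbf{v}_i\}$ and an associated set of generalized barycentric coordinates $\{\lambda_i\}$, and let $\mathcal{W}_{ij}:=\lambda_i\nabla\lambda_j-\lambda_j\nabla\lambda_i$. Then $$\sum_{i<j}\mathcal{W}_{ij}(\mathbf{v}_j-\mathbf{v}_i)^T=\mathbb{I},$$ where $\mathbb{I}$ is the $n\times n$ identity matrix. Further, define a map $\Phi:\mathcal{H}_1\Lambda^1(\mathbb{R}^n)\to\mathbb{M}_{n\times n}$ by $$\sum_{i=1}^n\left(\sum_{j=1}^n a_{ij}x_j\right)dx_i\longmapsto\left[\operatorname{sign}(a_{ij})\right].$$ Then for all $\omega\in\mathcal{H}_0\Lambda^2(\mathbb{R}^n)$, $$\sum_{i<j}\bigl((\Phi(\kappa\omega)\mathbf{v}_i)\cdot\mathbf{v}_j\bigr)\mathcal{W}_{ij}=(\Phi(\kappa\omega))\mathbf{x}.$$ Thus, $\operatorname{span}\{\mathcal{W}_{ij} : \mathbf{v}_i,\mathbf{v}_j\in\mathfrak{m}\}\supseteq\mathcal{P}_1^-\Lambda^1(\mathfrak{m})$.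
   Context: Generalized barycentric coordinates on $\mathfrak{m}$: non-negative functions $\lambda_i:\mathfrak{m}\to\mathbb{R}$, one for each vertex $\mathbf{v}_i$, such that every linear function $L$ (polynomial of degree at most 1) satisfies $L=\sum_i L(\mathbf{v}_i)\lambda_i$ on $\mathfrak{m}$. The vertices are indexed by an ordered finite set, and $\sum_{i<j}$ runs over pairs of vertex indices with $i<j$. Vectors (vertices, gradients, and the position $\mathbf{x}=(x_1,\ldots,x_n)^T$) are column vectors; $\mathbf{v}_i\in\mathfrak{m}$ in the span refers to vertices of $\mathfrak{m}$. The $\lambda_i$ are assumed differentiable wherever gradients are written: the identities and the span inclusion are understood as statements about functions of $\mathbf{x}$ on the set of points of $\mathfrak{m}$ at which all $\lambda_i$ are differentiable relative to $\mathfrak{m}$ (i.e. $\lambda_i(\mathbf{y})=\lambda_i(\mathbf{x})+\nabla\lambda_i(\mathbf{x})\cdot(\mathbf{y}-\mathbf{x})+o(|\mathbf{y}-\mathbf{x}|)$ for $\mathbf{y}\in\mathfrak{m}$). $\mathbb{M}_{n\times n}$ denotes real $n\times n$ matrices; $\operatorname{sign}(t)\in\{-1,0,1\}$ with $\operatorname{sign}(0)=0$. $\mathcal{H}_r\Lambda^k$ is the space of differential $k$-forms whose coefficients are homogeneous polynomials of degree $r$, and $\mathcal{P}_r\Lambda^k$ the space of $k$-forms with polynomial coefficients of degree at most $r$. The Koszul operator $\kappa$ is linear with $$\kappa\bigl(a(x)\,dx_{\sigma_1}\wedge\cdots\wedge dx_{\sigma_k}\bigr)=\sum_{i=1}^k(-1)^{i+1}a(x)\,x_{\sigma_i}\,dx_{\sigma_1}\wedge\cdots\wedge\widehat{dx_{\sigma_i}}\wedge\cdots\wedge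 dx_{\sigma_k}$$ (the hat means omission), and $\mathcal{P}_1^-\Lambda^k:=\mathcal{P}_0\Lambda^k\oplus\kappa\mathcal{H}_0\Lambda^{k+1}$. 1-forms are identified with vector fields via $u_1dx_1+\cdots+u_ndx_n\leftrightarrow(u_1,\ldots,u_n)^T$. Span means finite real linear combinations. *)

theory Defs
  imports "HOL-Analysis.Analysis" "HOL-Library.Function_Algebras"
begin

section \<open>Real vector spaces of functions\<close>

definition fscale :: "real \<Rightarrow> ('a \<Rightarrow> 'b::real_vector) \<Rightarrow> 'a \<Rightarrow> 'b"
  where "fscale c f = (\<lambda>x. c *\<^sub>R f x)"

lemma vector_space_fscale: "vector_space fscale"
  by unfold_locales (auto simp: fscale_def fun_eq_iff algebra_simps)

text \<open>Finite real linear combinations, with the pointwise operations on functions.\<close>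

abbreviation fun_span :: "('a \<Rightarrow> 'b::real_vector) set \<Rightarrow> ('a \<Rightarrow> 'b) set"
  where "fun_span \<equiv> module.span fscale"

text \<open>Restriction of a function to \<open>D\<close>; extending by zero keeps the restrictions a vector space.\<close>

definition restr :: "'a set \<Rightarrow> ('a \<Rightarrow> 'b::zero) \<Rightarrow> 'a \<Rightarrow> 'b"
  where "restr D f = (\<lambda>x. if x \<in> D then f x else 0)"


section \<open>Polynomial functions on \<open>\<real>\<^sup>n\<close>\<close>

definition monomial_fun :: "('n::finite \<Rightarrow> nat) \<Rightarrow> real ^ 'n \<Rightarrow> real"
  where "monomial_fun \<alpha> = (\<lambda>x. \<Prod>i\<in>UNIV. (x $ i) ^ \<alpha> i)"

definition hom_poly :: "nat \<Rightarrow> (real ^ 'n::finite \<Rightarrow> real) set"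
  where "hom_poly r = fun_span {monomial_fun \<alpha> | \<alpha>. (\<Sum>i\<in>UNIV. \<alpha> i) = r}"

definition poly_le :: "nat \<Rightarrow> (real ^ 'n::finite \<Rightarrow> real) set"
  where "poly_le r = fun_span {monomial_fun \<alpha> | \<alpha>. (\<Sum>i\<in>UNIV. \<alpha> i) \<le> r}"


section \<open>Differential forms on \<open>\<real>\<^sup>n\<close>\<close>

text \<open>
  A differential form is given by its coefficients in the basis
  \<open>dx\<^bsub>\<sigma>1\<^esub> \<and> \<dots> \<and> dx\<^bsub>\<sigma>k\<^esub>\<close> with \<open>\<sigma>1 < \<dots> < \<sigma>k\<close>: the value at the list \<open>\<sigma>\<close> is the coefficient
  function of that basis form. Values at lists that are not strictly increasing have no meaning
  and are required to be zero.
\<close>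

type_synonym 'n dform = "'n list \<Rightarrow> real ^ 'n \<Rightarrow> real"

definition forms_with :: "(real ^ 'n::{finite,linorder} \<Rightarrow> real) set \<Rightarrow> nat \<Rightarrow> 'n dform set"
  where "forms_with F k =
    {\<omega>. \<forall>\<sigma>. if sorted_wrt (<) \<sigma> \<and> length \<sigma> = k then \<omega> \<sigma> \<in> F else \<omega> \<sigma> = 0}"

definition HForms :: "nat \<Rightarrow> nat \<Rightarrow> ('n::{finite,linorder}) dform set"
  where "HForms r k = forms_with (hom_poly r) k"

definition PForms :: "nat \<Rightarrow> nat \<Rightarrow> ('n::{finite,linorder}) dform set"
  where "PForms r k = forms_with (poly_le r) k"

text \<open>The form \<open>a dx\<^bsub>\<sigma>1\<^esub> \<and> \<dots> \<and> dx\<^bsub>\<sigma>k\<^esub>\<close>, for strictly increasing \<open>\<sigma>\<close>.\<close>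

definition basic_form :: "(real ^ 'n::{finite,linorder} \<Rightarrow> real) \<Rightarrow> 'n list \<Rightarrow> 'n dform"
  where "basic_form a \<sigma> = (\<lambda>\<tau>. if \<tau> = \<sigma> then a else 0)"

definition omit :: "nat \<Rightarrow> 'a list \<Rightarrow> 'a list"
  where "omit i \<sigma> = take i \<sigma> @ drop (Suc i) \<sigma>"

text \<open>
  The Koszul operator, extended linearly from the basic forms. List positions start at \<open>0\<close>, so
  the sign \<open>(-1)\<^sup>i\<^sup>+\<^sup>1\<close> of the usual formula, with \<open>i\<close> starting at \<open>1\<close>, becomes \<open>(-1)\<^sup>i\<close>.
\<close>

definition koszul :: "('n::{finite,linorder}) dform \<Rightarrow> 'n dform"
  where "koszul \<omega> = (\<Sum>\<sigma> | sorted_wrt (<) \<sigma>. \<Sum>i<length \<sigma>.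
    basic_form (\<lambda>x. (-1) ^ i * \<omega> \<sigma> x * x $ (\<sigma> ! i)) (omit i \<sigma>))"

lemma finite_strict_sorted: "finite {\<sigma> :: ('n::{finite,linorder}) list. sorted_wrt (<) \<sigma>}"
proof (rule finite_subset)
  show "{\<sigma> :: 'n list. sorted_wrt (<) \<sigma>} \<subseteq> {\<sigma>. set \<sigma> \<subseteq> UNIV \<and> distinct \<sigma>}"
    by (auto simp: strict_sorted_iff)
  show "finite {\<sigma> :: 'n list. set \<sigma> \<subseteq> UNIV \<and> distinct \<sigma>}"
    by (rule finite_subset_distinct) simp
qed

lemma koszul_basic_form:
  assumes "sorted_wrt (<) \<sigma>"
  shows "koszul (basic_form a \<sigma>) =
    (\<Sum>i<length \<sigma>. basic_form (\<lambda>x. (-1) ^ i * a x * x $ (\<sigma> ! i)) (omit i \<sigma>))"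
proof -
  have z: "basic_form (\<lambda>x. (-1) ^ i * basic_form a \<sigma> \<tau> x * x $ (\<tau> ! i)) (omit i \<tau>) = 0"
    if "\<tau> \<noteq> \<sigma>" for i \<tau>
    using that by (auto simp: basic_form_def fun_eq_iff)
  have "koszul (basic_form a \<sigma>) = (\<Sum>\<tau>\<in>{\<sigma>}. \<Sum>i<length \<tau>.
     basic_form (\<lambda>x. (-1) ^ i * basic_form a \<sigma> \<tau> x * x $ (\<tau> ! i)) (omit i \<tau>))"
    unfolding koszul_def
    by (rule sum.mono_neutral_right) (use assms z finite_strict_sorted in auto)
  then show ?thesis
    by (simp add: basic_form_def)
qed

text \<open>
  \<open>\<P>\<^sub>1\<^sup>-\<Lambda>\<^sup>k = \<P>\<^sub>0\<Lambda>\<^sup>k \<oplus> \<kappa>\<H>\<^sub>0\<Lambda>\<^sup>k\<^sup>+\<^sup>1\<close>. The sum is direct because the coefficients of \<open>\<kappa>\<beta>\<close> vanish at the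
  origin.
\<close>

definition P1minus :: "nat \<Rightarrow> ('n::{finite,linorder}) dform set"
  where "P1minus k = {\<alpha> + koszul \<beta> | \<alpha> \<beta>. \<alpha> \<in> PForms 0 k \<and> \<beta> \<in> HForms 0 (Suc k)}"

definition vector_proxy :: "'n dform \<Rightarrow> real ^ ('n::{finite,linorder}) \<Rightarrow> real ^ ('n::{finite,linorder})"
  where "vector_proxy \<omega> = (\<lambda>x. \<chi> i. \<omega> [i] x)"

text \<open>
  The matrix \<open>(a\<^sub>i\<^sub>j)\<close> of the 1-form \<open>\<Sum>\<^sub>i (\<Sum>\<^sub>j a\<^sub>i\<^sub>j x\<^sub>j) dx\<^sub>i\<close>, and the map \<open>\<Phi>\<close>. Both are meaningful
  on \<open>HForms 1 1\<close> only.
\<close>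

definition coeff_matrix :: "'n dform \<Rightarrow> real ^ ('n::{finite,linorder}) ^ ('n::{finite,linorder})"
  where "coeff_matrix \<omega> = (THE A. \<forall>i x. \<omega> [i] x = (\<Sum>j\<in>UNIV. A $ i $ j * x $ j))"

definition Phi :: "'n dform \<Rightarrow> real ^ ('n::{finite,linorder}) ^ ('n::{finite,linorder})"
  where "Phi \<omega> = (\<chi> i j. sgn (coeff_matrix \<omega> $ i $ j))"

lemma coeff_matrix_eq:
  assumes "\<And>i x. \<omega> [i] x = (\<Sum>j\<in>UNIV. A $ i $ j * x $ j)"
  shows "coeff_matrix \<omega> = A"
  unfolding coeff_matrix_def
proof (rule the_equality)
  fix B
  assume B: "\<forall>i x. \<omega> [i] x = (\<Sum>j\<in>UNIV. B $ i $ j * x $ j)"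
  have "B *v x = A *v x" for x
    using B assms by (simp add: vec_eq_iff matrix_vector_mult_def)
  then show "B = A"
    by (simp add: matrix_eq)
qed (use assms in auto)


section \<open>Generalized barycentric coordinates\<close>

definition bary_coords ::
    "(real ^ 'n::finite) set \<Rightarrow> 'i set \<Rightarrow> ('i \<Rightarrow> real ^ 'n) \<Rightarrow> ('i \<Rightarrow> real ^ 'n \<Rightarrow> real) \<Rightarrow> bool"
  where "bary_coords M I v lam \<longleftrightarrow>
    (\<forall>i\<in>I. \<forall>x\<in>M. 0 \<le> lam i x) \<and>
    (\<forall>L\<in>poly_le 1. \<forall>x\<in>M. L x = (\<Sum>i\<in>I. L (v i) * lam i x))"

text \<open>
  The gradient relative to \<open>M\<close>. It is unique at every point of \<open>M\<close> when \<open>M\<close> is convex with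
  nonempty interior, boundary points included.
\<close>

definition grad_within ::
    "(real ^ 'n::finite) set \<Rightarrow> (real ^ 'n \<Rightarrow> real) \<Rightarrow> real ^ 'n \<Rightarrow> real ^ 'n"
  where "grad_within M f x = (THE g. (f has_derivative (\<lambda>h. g \<bullet> h)) (at x within M))"

definition diff_points ::
    "(real ^ 'n::finite) set \<Rightarrow> 'i set \<Rightarrow> ('i \<Rightarrow> real ^ 'n \<Rightarrow> real) \<Rightarrow> (real ^ 'n) set"
  where "diff_points M I lam = {x \<in> M. \<forall>i\<in>I. lam i differentiable (at x within M)}"

definition whitney ::
    "(real ^ 'n::finite) set \<Rightarrow> ('i \<Rightarrow> real ^ 'n \<Rightarrow> real) \<Rightarrow> 'i \<Rightarrow> 'i \<Rightarrow> real ^ 'n \<Rightarrow> real ^ 'n"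
  where "whitney M lam i j =
    (\<lambda>x. lam i x *\<^sub>R grad_within M (lam j) x - lam j x *\<^sub>R grad_within M (lam i) x)"

end

theory Submission
  imports Defs
begin

text \<open>
  Differentiating \<open>\<Sum> \<lambda>\<^sub>i = 1\<close> and \<open>\<Sum> \<lambda>\<^sub>i v\<^sub>i = x\<close> gives \<open>\<Sum> \<nabla>\<lambda>\<^sub>i = 0\<close> and \<open>\<Sum> \<nabla>\<lambda>\<^sub>i v\<^sub>i\<^sup>T = \<I>\<close>. For skew
  coefficients \<open>b\<^sub>i\<^sub>j\<close> the sum of \<open>b\<^sub>i\<^sub>j \<W>\<^sub>i\<^sub>j\<close> over \<open>i < j\<close> is \<open>\<Sum>\<^sub>j (\<Sum>\<^sub>i \<lambda>\<^sub>i b\<^sub>i\<^sub>j) \<nabla>\<lambda>\<^sub>j\<close>. Taking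
  \<open>b\<^sub>i\<^sub>j = (v\<^sub>j - v\<^sub>i) \<bullet> c\<close> this is \<open>c\<close>, and taking \<open>b\<^sub>i\<^sub>j = A v\<^sub>i \<bullet> v\<^sub>j\<close> with \<open>A\<close> skew it is \<open>A x\<close>. Every field in
  \<open>\<P>\<^sub>1\<^sup>-\<Lambda>\<^sup>1\<close> has the form \<open>c + A x\<close> with \<open>A\<close> skew, and \<open>\<Phi>\<close> preserves skewness because \<open>sgn\<close> is odd.
\<close>

section \<open>Derivatives relative to a convex body\<close>

text \<open>Both derivatives agree on \<open>y - x\<close> for \<open>y\<close> in \<open>S\<close>,
  because the segment from \<open>x\<close> to \<open>y\<close> stays in \<open>S\<close>. As
  \<open>S\<close> contains a ball, every vector is a multiple of a difference of two such
  directions, so linearity settles the rest. Boundary points \<open>x\<close> are covered.\<close>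

lemma has_derivative_unique_within_convex:
  fixes f :: "'a::euclidean_space \<Rightarrow> 'b::real_normed_vector"
  assumes S: "convex S" "interior S \<noteq> {}" "x \<in> S"
    and f': "(f has_derivative f') (at x within S)"
    and f'': "(f has_derivative f'') (at x within S)"
  shows "f' = f''"
proof -
  have lin: "linear f'" "linear f''"
    using f' f'' by (auto dest: has_derivative_linear)
  have along: "f' (y - x) = f'' (y - x)" if y: "y \<in> S" for y
  proof -
    define p where "p = (\<lambda>t::real. x + t *\<^sub>R (y - x))"
    have p: "p ` {0..1} \<subseteq> S"
    proof clarsimp
      fix t :: real assume "0 \<le> t" "t \<le> 1"
      then have "(1 - t) *\<^sub>R x + t *\<^sub>R y \<in> S"
        using S y by (simp add: convexD_alt)
      then show "p t \<in> S" by (simp add: p_def algebra_simps)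
    qed
    have dp: "(p has_derivative (\<lambda>t. t *\<^sub>R (y - x))) (at 0 within {0..1})"
      unfolding p_def by (auto intro!: derivative_eq_intros)
    have vd: "((\<lambda>t. f (p t)) has_vector_derivative g (y - x)) (at 0 within {0..1})"
      if g: "(f has_derivative g) (at x within S)" for g
    proof -
      have "(f has_derivative g) (at (p 0) within p ` {0..1})"
        using has_derivative_subset[OF g p] by (simp add: p_def)
      from has_derivative_in_compose[OF dp this] show ?thesis
        using has_derivative_linear[OF g]
        by (simp add: has_vector_derivative_def linear_cmul)
    qed
    show ?thesis
      \<comment> \<open>Along the segment, both values are the one-sided derivative of
        \<open>f o p\<close> at the endpoint 0 of the unit interval.\<close>
      by (rule vector_derivative_unique_within_closed_interval[of 0 1 0, unfolded cbox_interval,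
            OF _ _ vd[OF f'] vd[OF f'']]) auto
  qed
  obtain z e where e: "e > 0" and z: "ball z e \<subseteq> S"
    using S(2) by (auto simp: mem_interior)
  show ?thesis
  proof
    fix h :: 'a
    \<comment> \<open>Small enough that \<open>z + t *\<^sub>R h\<close> stays in the ball around
      \<open>z\<close>; the \<open>+ 1\<close> keeps the denominator positive when
      \<open>h = 0\<close>.\<close>
    define t where "t = e / (2 * (norm h + 1))"
    have t: "t > 0" using e by (simp add: t_def add_nonneg_pos)
    have "t * norm h < e"
    proof -
      have "t * norm h \<le> t * (norm h + 1)" using t by simp
      also have "\<dots> = e / 2"
        unfolding t_def using norm_ge_zero[of h] by (simp add: field_simps add_nonneg_eq_0_iff)
      finally show ?thesis using e by simp
    qed
    then have "z + t *\<^sub>R h \<in> S" "z \<in> S"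
      using z e t by (auto simp: subset_iff dist_norm)
    from along[OF this(1)] along[OF this(2)]
    have "f' ((z + t *\<^sub>R h - x) - (z - x)) = f'' ((z + t *\<^sub>R h - x) - (z - x))"
      using lin by (simp only: linear_diff)
    then have "t *\<^sub>R f' h = t *\<^sub>R f'' h"
      using lin by (simp add: linear_cmul)
    then show "f' h = f'' h" using t by simp
  qed
qed

text \<open>A linear functional is the inner product with a vector, and uniqueness of the derivative
  makes that vector the only candidate for the \<open>THE\<close> in
  \<open>grad_within\<close>.\<close>

lemma has_derivative_grad_within:
  fixes M :: "(real ^ 'n::finite) set"
  assumes M: "convex M" "interior M \<noteq> {}" "x \<in> M"
    and f: "f differentiable (at x within M)"
  shows "(f has_derivative (\<lambda>h. grad_within M f x \<bullet> h)) (at x within M)"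
proof -
  obtain D where D: "(f has_derivative D) (at x within M)"
    using f by (auto simp: differentiable_def)
  \<comment> \<open>The vector representing \<open>D\<close>:
    \<open>g \<bullet> h = 1 * D h\<close>.\<close>
  define g where "g = adjoint D 1"
  have "D h = g \<bullet> h" for h
    using adjoint_works[OF has_derivative_linear[OF D], of h 1]
    by (simp add: g_def inner_commute)
  then have g: "(f has_derivative (\<lambda>h. g \<bullet> h)) (at x within M)"
    using D by presburger
  have "g' = g" if "(f has_derivative (\<lambda>h. g' \<bullet> h)) (at x within M)" for g'
  proof -
    from has_derivative_unique_within_convex[OF M that g]
    show ?thesis by (metis vector_eq_rdot)
  qed
  then show ?thesis
    unfolding grad_within_def
    by (rule theI[where P = "\<lambda>g. (f has_derivative (\<lambda>h. g \<bullet> h)) (at x within M)", OF g])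
qed

section \<open>Skew combinations of Whitney functions\<close>

text \<open>The diagonal contributes nothing, and swapping coordinates carries the pairs below it to
  those above it.\<close>

lemma sum_Times_less:
  fixes f :: "'i::linorder \<Rightarrow> 'i \<Rightarrow> 'a::comm_monoid_add"
  assumes "finite I" and "\<And>i. f i i = 0"
  shows "(\<Sum>i\<in>I. \<Sum>j\<in>I. f i j) = (\<Sum>(i, j) | i \<in> I \<and> j \<in> I \<and> i < j. f i j + f j i)"
proof -
  let ?L = "{(i, j). i \<in> I \<and> j \<in> I \<and> i < j}"
  let ?G = "{(i, j). i \<in> I \<and> j \<in> I \<and> j < i}"
  have fin: "finite ?L" "finite ?G"
    by (rule finite_subset[of _ "I \<times> I"]; use assms(1) in auto)+
  have "(\<Sum>i\<in>I. \<Sum>j\<in>I. f i j) = (\<Sum>(i, j)\<in>I \<times> I. f i j)"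
    by (simp add: sum.cartesian_product)
  also have "\<dots> = (\<Sum>(i, j)\<in>?L \<union> ?G. f i j)"
    by (rule sum.mono_neutral_right) (use assms in \<open>auto simp: not_less_iff_gr_or_eq\<close>)
  also have "\<dots> = (\<Sum>(i, j)\<in>?L. f i j) + (\<Sum>(i, j)\<in>?G. f i j)"
    by (rule sum.union_disjoint) (use fin in auto)
  also have "(\<Sum>(i, j)\<in>?G. f i j) = (\<Sum>(i, j)\<in>?L. f j i)"
    by (rule sum.reindex_bij_witness[of _ prod.swap prod.swap]) auto
  finally show ?thesis
    by (simp add: sum.distrib case_prod_unfold)
qed

text \<open>By skewness the terms of the right-hand side at \<open>(i, j)\<close> and
  \<open>(j, i)\<close> combine into one Whitney term. In use, \<open>l\<close> and \<open>g\<close>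
  are the values and the gradients of the coordinates at a fixed point.\<close>

lemma sum_less_skew_whitney:
  fixes g :: "'i::linorder \<Rightarrow> 'a::real_vector" and b :: "'i \<Rightarrow> 'i \<Rightarrow> real"
  assumes "finite I" and skew: "\<And>i j. b j i = - b i j"
  shows "(\<Sum>(i, j) | i \<in> I \<and> j \<in> I \<and> i < j. b i j *\<^sub>R (l i *\<^sub>R g j - l j *\<^sub>R g i))
    = (\<Sum>j\<in>I. (\<Sum>i\<in>I. l i * b i j) *\<^sub>R g j)"
proof -
  have diag: "b i i = 0" for i using skew[of i i] by linarith
  have "(\<Sum>j\<in>I. (\<Sum>i\<in>I. l i * b i j) *\<^sub>R g j) = (\<Sum>i\<in>I. \<Sum>j\<in>I. (l i * b i j) *\<^sub>R g j)"
    unfolding scaleR_left.sum by (rule sum.swap)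
  also have "\<dots> = (\<Sum>(i, j) | i \<in> I \<and> j \<in> I \<and> i < j.
      (l i * b i j) *\<^sub>R g j + (l j * b j i) *\<^sub>R g i)"
    by (rule sum_Times_less) (use assms(1) diag in auto)
  also have "\<dots> = (\<Sum>(i, j) | i \<in> I \<and> j \<in> I \<and> i < j. b i j *\<^sub>R (l i *\<^sub>R g j - l j *\<^sub>R g i))"
  proof (intro sum.cong refl, clarify)
    fix i j
    show "(l i * b i j) *\<^sub>R g j + (l j * b j i) *\<^sub>R g i
        = b i j *\<^sub>R (l i *\<^sub>R g j - l j *\<^sub>R g i)"
      by (simp add: skew[of i j] algebra_simps)
  qed
  finally show ?thesis ..
qed

section \<open>Gradients of barycentric coordinates\<close>

lemma module_fscale: "module fscale"
  using vector_space_fscale by (simp add: module_iff_vector_space)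

lemma sum_apply_fun: "(\<Sum>i\<in>A. f i) x = (\<Sum>i\<in>A. f i x)"
  by (induction A rule: infinite_finite_induct) auto

lemma const_in_poly_le_1: "(\<lambda>x. 1) \<in> poly_le 1"
proof -
  have "monomial_fun (\<lambda>_. 0) \<in> poly_le 1"
    unfolding poly_le_def by (rule module.span_base[OF module_fscale]) auto
  then show ?thesis by (simp add: monomial_fun_def)
qed

lemma coord_in_poly_le_1: "(\<lambda>x. x $ k) \<in> poly_le 1"
proof -
  have "monomial_fun (\<lambda>i. if i = k then 1 else 0) \<in> poly_le 1"
    unfolding poly_le_def by (rule module.span_base[OF module_fscale]) auto
  moreover have "monomial_fun (\<lambda>i. if i = k then 1 else 0) = (\<lambda>x. x $ k)"
    by (simp add: monomial_fun_def fun_eq_iff if_distrib cong: if_cong)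
  ultimately show ?thesis by simp
qed

lemma bary_coords_sum:
  assumes "bary_coords M I v lam" "x \<in> M"
  shows "(\<Sum>i\<in>I. lam i x) = 1"
proof -
  have "\<forall>L\<in>poly_le 1. L x = (\<Sum>i\<in>I. L (v i) * lam i x)"
    using assms by (simp add: bary_coords_def)
  from bspec[OF this const_in_poly_le_1] show ?thesis by simp
qed

lemma bary_coords_sum_vertices:
  assumes "bary_coords M I v lam" "x \<in> M"
  shows "(\<Sum>i\<in>I. lam i x *\<^sub>R v i) = x"
proof -
  have "\<forall>L\<in>poly_le 1. L x = (\<Sum>i\<in>I. L (v i) * lam i x)"
    using assms by (simp add: bary_coords_def)
  from bspec[OF this coord_in_poly_le_1] show ?thesis
    by (simp add: vec_eq_iff mult.commute)
qed

context
  fixes M :: "(real ^ 'n::finite) set" and I :: "'i set" and v lam x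
  assumes M: "convex M" "interior M \<noteq> {}"
    and bary: "bary_coords M I v lam"
    and x: "x \<in> diff_points M I lam"
begin

lemma diff_points_mem: "x \<in> M"
  using x by (simp add: diff_points_def)

lemma diff_points_has_derivative:
  assumes "i \<in> I"
  shows "(lam i has_derivative (\<lambda>h. grad_within M (lam i) x \<bullet> h)) (at x within M)"
  using x assms M by (intro has_derivative_grad_within) (auto simp: diff_points_def)

lemma sum_grad: "(\<Sum>i\<in>I. grad_within M (lam i) x) = 0"
proof -
  have "((\<lambda>y. \<Sum>i\<in>I. lam i y) has_derivative (\<lambda>h. \<Sum>i\<in>I. grad_within M (lam i) x \<bullet> h))
      (at x within M)"
    by (intro has_derivative_sum diff_points_has_derivative)
  moreover have "((\<lambda>y. \<Sum>i\<in>I. lam i y) has_derivative (\<lambda>h. 0)) (at x within M)"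
    \<comment> \<open>The sum equals 1 on \<open>M\<close> only, which suffices for a derivative
      within \<open>M\<close>.\<close>
    by (rule has_derivative_transform[OF diff_points_mem _ has_derivative_const[of 1]])
      (simp add: bary_coords_sum[OF bary])
  ultimately have "(\<lambda>h. \<Sum>i\<in>I. grad_within M (lam i) x \<bullet> h) = (\<lambda>h. 0)"
    by (rule has_derivative_unique_within_convex[OF M diff_points_mem])
  then have "(\<Sum>i\<in>I. grad_within M (lam i) x) \<bullet> h = 0" for h
    by (simp add: inner_sum_left fun_eq_iff)
  then show ?thesis by (metis inner_eq_zero_iff)
qed

text \<open>Differentiates the reproduction of the position vector in direction
  \<open>h\<close>.\<close>

lemma sum_grad_inner_vertices: "(\<Sum>i\<in>I. (grad_within M (lam i) x \<bullet> h) *\<^sub>R v i) = h"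
proof -
  have "((\<lambda>y. \<Sum>i\<in>I. lam i y *\<^sub>R v i) has_derivative
      (\<lambda>h. \<Sum>i\<in>I. (grad_within M (lam i) x \<bullet> h) *\<^sub>R v i)) (at x within M)"
    by (intro has_derivative_sum has_derivative_scaleR_left diff_points_has_derivative)
  moreover have "((\<lambda>y. \<Sum>i\<in>I. lam i y *\<^sub>R v i) has_derivative (\<lambda>h. h)) (at x within M)"
    by (rule has_derivative_transform[OF diff_points_mem _ has_derivative_ident])
      (simp add: bary_coords_sum_vertices[OF bary])
  ultimately have "(\<lambda>h. \<Sum>i\<in>I. (grad_within M (lam i) x \<bullet> h) *\<^sub>R v i) = (\<lambda>h. h)"
    by (rule has_derivative_unique_within_convex[OF M diff_points_mem])
  then show ?thesis by (rule fun_cong)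
qed

text \<open>The transpose of the preceding identity, obtained by pairing with an arbitrary
  \<open>h\<close>.\<close>

lemma sum_inner_vertices_grad: "(\<Sum>i\<in>I. (c \<bullet> v i) *\<^sub>R grad_within M (lam i) x) = c"
proof -
  have "(\<Sum>i\<in>I. (c \<bullet> v i) *\<^sub>R grad_within M (lam i) x) \<bullet> h
      = c \<bullet> (\<Sum>i\<in>I. (grad_within M (lam i) x \<bullet> h) *\<^sub>R v i)" for h
    by (simp add: inner_sum_left inner_sum_right mult.commute)
  then show ?thesis
    by (subst vector_eq_rdot[symmetric]) (simp add: sum_grad_inner_vertices)
qed

end

section \<open>Reproduction of affine fields with skew linear part\<close>

context
  fixes M :: "(real ^ 'n::finite) set" and I :: "'i::linorder set" and v lam x
  assumes M: "convex M" "interior M \<noteq> {}"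
    and I: "finite I"
    and bary: "bary_coords M I v lam"
    and x: "x \<in> diff_points M I lam"
begin

text \<open>The coefficient of the \<open>j\<close>-th gradient is
  \<open>c \<bullet> v j - c \<bullet> x\<close>. The part with \<open>c \<bullet> x\<close> does
  not depend on \<open>j\<close> and drops out because the gradients sum to zero.\<close>

lemma whitney_const:
  "(\<Sum>(i, j) | i \<in> I \<and> j \<in> I \<and> i < j. (c \<bullet> (v j - v i)) *\<^sub>R whitney M lam i j x) = c"
proof -
  have xM: "x \<in> M" using x by (simp add: diff_points_def)
  have "(\<Sum>i\<in>I. lam i x * (c \<bullet> (v j - v i)))
      = (\<Sum>i\<in>I. lam i x) * (c \<bullet> v j) - c \<bullet> (\<Sum>i\<in>I. lam i x *\<^sub>R v i)" for j
    by (simp add: inner_diff_right inner_sum_right sum_subtractf right_diff_distrib sum_distrib_right)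
  then have "(\<Sum>i\<in>I. lam i x * (c \<bullet> (v j - v i))) = c \<bullet> v j - c \<bullet> x" for j
    by (simp add: bary_coords_sum[OF bary xM] bary_coords_sum_vertices[OF bary xM])
  then have "(\<Sum>(i, j) | i \<in> I \<and> j \<in> I \<and> i < j. (c \<bullet> (v j - v i)) *\<^sub>R whitney M lam i j x)
      = (\<Sum>j\<in>I. (c \<bullet> v j - c \<bullet> x) *\<^sub>R grad_within M (lam j) x)"
    unfolding whitney_def by (subst sum_less_skew_whitney[OF I]) (auto simp: inner_diff_right)
  also have "\<dots> = (\<Sum>j\<in>I. (c \<bullet> v j) *\<^sub>R grad_within M (lam j) x)
      - (c \<bullet> x) *\<^sub>R (\<Sum>j\<in>I. grad_within M (lam j) x)"
    by (simp add: scaleR_left_diff_distrib sum_subtractf scaleR_right.sum)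
  finally show ?thesis
    by (simp add: sum_grad[OF M bary x] sum_inner_vertices_grad[OF M bary x])
qed

text \<open>Linearity of \<open>A\<close> turns the coefficient of the \<open>j\<close>-th gradient
  into \<open>(A *v x) \<bullet> v j\<close>, so the gradients reproduce
  \<open>A *v x\<close>.\<close>

lemma whitney_linear_skew:
  fixes A :: "real ^ 'n ^ 'n"
  assumes A: "transpose A = - A"
  shows "(\<Sum>(i, j) | i \<in> I \<and> j \<in> I \<and> i < j. ((A *v v i) \<bullet> v j) *\<^sub>R whitney M lam i j x) = A *v x"
proof -
  have xM: "x \<in> M" using x by (simp add: diff_points_def)
  have skew: "(A *v v j) \<bullet> v i = - ((A *v v i) \<bullet> v j)" for i j
  proof -
    have "(A *v v j) \<bullet> v i = v j \<bullet> (transpose A *v v i)"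
      by (metis dot_lmul_matrix inner_commute transpose_matrix_vector)
    also have "transpose A *v v i = - (A *v v i)"
      unfolding A by (simp add: vec_eq_iff matrix_vector_mult_def sum_negf)
    finally show ?thesis by (simp add: inner_commute)
  qed
  have "(\<Sum>i\<in>I. lam i x * ((A *v v i) \<bullet> v j)) = (A *v (\<Sum>i\<in>I. lam i x *\<^sub>R v i)) \<bullet> v j" for j
    by (simp add: inner_sum_left linear_sum[OF matrix_vector_mul_linear]
        matrix_vector_mult_scaleR)
  then have "(\<Sum>i\<in>I. lam i x * ((A *v v i) \<bullet> v j)) = (A *v x) \<bullet> v j" for j
    by (simp add: bary_coords_sum_vertices[OF bary xM])
  then have "(\<Sum>(i, j) | i \<in> I \<and> j \<in> I \<and> i < j. ((A *v v i) \<bullet> v j) *\<^sub>R whitney M lam i j x)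
      = (\<Sum>j\<in>I. ((A *v x) \<bullet> v j) *\<^sub>R grad_within M (lam j) x)"
    unfolding whitney_def by (subst sum_less_skew_whitney[OF I skew]) simp
  then show ?thesis
    by (simp add: sum_inner_vertices_grad[OF M bary x])
qed

end

lemma affine_skew_in_span_whitney:
  fixes M :: "(real ^ 'n::finite) set" and I :: "'i::linorder set" and A :: "real ^ 'n ^ 'n"
  assumes "convex M" "interior M \<noteq> {}" "finite I" "bary_coords M I v lam"
    and "transpose A = - A"
  shows "restr (diff_points M I lam) (\<lambda>x. c + A *v x)
    \<in> fun_span {restr (diff_points M I lam) (whitney M lam i j) | i j. i \<in> I \<and> j \<in> I}"
    (is "restr ?D _ \<in> fun_span ?W")
proof -
  \<comment> \<open>These coefficients are independent of \<open>x\<close>, so the pointwise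
    identities become a linear combination of functions. Off \<open>?D\<close> both sides
    vanish.\<close>
  let ?b = "\<lambda>i j. c \<bullet> (v j - v i) + (A *v v i) \<bullet> v j"
  have "restr ?D (\<lambda>x. c + A *v x) = (\<Sum>(i, j) | i \<in> I \<and> j \<in> I \<and> i < j.
      fscale (?b i j) (restr ?D (whitney M lam i j)))"
  proof
    fix x
    have "restr ?D (\<lambda>x. c + A *v x) x
        = (\<Sum>(i, j) | i \<in> I \<and> j \<in> I \<and> i < j. ?b i j *\<^sub>R restr ?D (whitney M lam i j) x)"
    proof (cases "x \<in> ?D")
      case True
      note whitney_const[OF assms(1-4) True, of c] whitney_linear_skew[OF assms(1-4) True assms(5)]
      then show ?thesis
        using True by (simp add: restr_def scaleR_left_distrib sum.distrib case_prod_unfold)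
    qed (simp add: restr_def)
    then show "restr ?D (\<lambda>x. c + A *v x) x = (\<Sum>(i, j) | i \<in> I \<and> j \<in> I \<and> i < j.
        fscale (?b i j) (restr ?D (whitney M lam i j))) x"
      by (simp add: fscale_def sum_apply_fun case_prod_unfold)
  qed
  also have "\<dots> \<in> fun_span ?W"
    by (rule module.span_sum[OF module_fscale], clarify, rule module.span_scale[OF module_fscale],
        rule module.span_base[OF module_fscale]) blast
  finally show ?thesis .
qed

section \<open>The fields in \<open>\<P>\<^sub>1\<^sup>-\<Lambda>\<^sup>1\<close>\<close>

lemma span_const_fun:
  assumes "f \<in> fun_span {\<lambda>x. 1}"
  shows "\<exists>c::real. f = (\<lambda>x. c)"
  using assms
  by (auto simp: module.span_singleton[OF module_fscale] fscale_def)

lemma hom_poly_0_const: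
  assumes "f \<in> hom_poly 0"
  shows "\<exists>c. f = (\<lambda>x. c)"
proof -
  \<comment> \<open>Only the zero exponent has total degree 0.\<close>
  have "{monomial_fun \<alpha> | \<alpha>. (\<Sum>i\<in>UNIV. \<alpha> i) = 0} = {\<lambda>x :: real ^ 'a. 1}"
    by (auto simp: monomial_fun_def fun_eq_iff intro!: exI[of _ "\<lambda>_. 0"])
  then show ?thesis using assms span_const_fun by (simp add: hom_poly_def)
qed

lemma poly_le_0_eq_hom_poly_0: "poly_le 0 = hom_poly 0"
  by (simp add: poly_le_def hom_poly_def)

text \<open>Encodes \<open>\<kappa>(dx_a \<and> dx_b) = x_a dx_b - x_b dx_a\<close> for
  \<open>a < b\<close>. The coefficients of a form in \<open>HForms 0 2\<close> are constant, so
  they are read off at the origin.\<close>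

definition koszul_matrix ::
    "('n::{finite,linorder}) dform \<Rightarrow> real ^ ('n::{finite,linorder}) ^ ('n::{finite,linorder})"
  where "koszul_matrix \<omega> =
    (\<chi> i j. if j < i then \<omega> [j, i] 0 else if i < j then - \<omega> [i, j] 0 else 0)"

lemma transpose_koszul_matrix: "transpose (koszul_matrix \<omega>) = - koszul_matrix \<omega>"
  by (auto simp: koszul_matrix_def transpose_def vec_eq_iff)

lemma koszul_HForms_0_2:
  fixes \<omega> :: "('n::{finite,linorder}) dform"
  assumes "\<omega> \<in> HForms 0 2"
  shows "koszul \<omega> [k] x = (\<Sum>j\<in>UNIV. koszul_matrix \<omega> $ k $ j * x $ j)"
proof -
  have const: "\<omega> \<sigma> y = \<omega> \<sigma> 0" for \<sigma> y
  proof (cases "sorted_wrt (<) \<sigma> \<and> length \<sigma> = 2")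
    case True
    then have "\<omega> \<sigma> \<in> hom_poly 0"
      using assms by (auto simp: HForms_def forms_with_def split: if_splits)
    from hom_poly_0_const[OF this] show ?thesis by auto
  next
    case False
    then have "\<omega> \<sigma> = 0"
      using assms by (auto simp: HForms_def forms_with_def split: if_splits)
    then show ?thesis by simp
  qed
  have zero: "\<omega> \<sigma> = 0" if "length \<sigma> \<noteq> 2" for \<sigma>
    using assms that by (auto simp: HForms_def forms_with_def split: if_splits)
  \<comment> \<open>What deleting position \<open>i\<close> of \<open>\<sigma>\<close> contributes
    to the coefficient of \<open>dx_k\<close>.\<close>
  let ?t = "\<lambda>\<sigma> i. if omit i \<sigma> = [k] then (-1) ^ i * \<omega> \<sigma> 0 * x $ (\<sigma> ! i) else 0"
  let ?P = "{(a :: 'n, b). a < b}"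
  have inj: "inj_on (\<lambda>(a, b). [a, b]) ?P" by (auto simp: inj_on_def)
  have "koszul \<omega> [k] x = (\<Sum>\<sigma> | sorted_wrt (<) \<sigma>. \<Sum>i<length \<sigma>. ?t \<sigma> i)"
    unfolding koszul_def sum_apply_fun basic_form_def
    by (intro sum.cong refl) (auto simp: const[of _ x])
  also have "\<dots> = (\<Sum>\<sigma>\<in>(\<lambda>(a, b). [a, b]) ` ?P. \<Sum>i<length \<sigma>. ?t \<sigma> i)"
  proof (rule sum.mono_neutral_right)
    show "\<forall>\<sigma>\<in>{\<sigma>. sorted_wrt (<) \<sigma>} - (\<lambda>(a, b). [a, b]) ` ?P. (\<Sum>i<length \<sigma>. ?t \<sigma> i) = 0"
    proof
      fix \<sigma> :: "'n list" assume \<sigma>: "\<sigma> \<in> {\<sigma>. sorted_wrt (<) \<sigma>} - (\<lambda>(a, b). [a, b]) ` ?P"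
      have "length \<sigma> \<noteq> 2"
      proof
        assume "length \<sigma> = 2"
        then obtain a b where "\<sigma> = [a, b]" by (auto simp: length_Suc_conv numeral_2_eq_2)
        then show False using \<sigma> by auto
      qed
      then show "(\<Sum>i<length \<sigma>. ?t \<sigma> i) = 0" by (auto simp: zero intro!: sum.neutral)
    qed
  qed (auto simp: finite_strict_sorted)
  also have "\<dots> = (\<Sum>(a, b)\<in>?P. \<Sum>i<2. ?t [a, b] i)"
    by (subst sum.reindex[OF inj]) (simp add: case_prod_unfold numeral_2_eq_2)
  \<comment> \<open>Deleting position 0 leaves \<open>[b]\<close> with sign plus, deleting position
    1 leaves \<open>[a]\<close> with sign minus.\<close>
  also have "\<dots> = (\<Sum>(a, b)\<in>?P. (if b = k then \<omega> [a, b] 0 * x $ a else 0)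
      + (if a = k then - \<omega> [a, b] 0 * x $ b else 0))"
    by (intro sum.cong refl) (auto simp: numeral_2_eq_2 omit_def)
  also have "\<dots> = (\<Sum>(a, b)\<in>UNIV. (if a < b \<and> b = k then \<omega> [a, b] 0 * x $ a else 0)
      + (if a < b \<and> a = k then - \<omega> [a, b] 0 * x $ b else 0))"
    by (rule sum.mono_neutral_cong_left) (auto split: if_splits)
  also have "\<dots> = (\<Sum>a\<in>UNIV. \<Sum>b\<in>UNIV. if b = k then (if a < k then \<omega> [a, k] 0 * x $ a else 0) else 0)
      + (\<Sum>a\<in>UNIV. \<Sum>b\<in>UNIV. if a = k then (if k < b then - \<omega> [k, b] 0 * x $ b else 0) else 0)"
    unfolding UNIV_Times_UNIV[symmetric] sum.cartesian_product sum.distrib[symmetric]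
    by (intro sum.cong refl) auto
  also have "(\<Sum>a\<in>UNIV. \<Sum>b\<in>UNIV. if a = k then (if k < b then - \<omega> [k, b] 0 * x $ b else 0) else 0)
      = (\<Sum>b\<in>UNIV. if k < b then - \<omega> [k, b] 0 * x $ b else 0)"
    by (subst sum.swap) simp
  also have "(\<Sum>a\<in>UNIV. \<Sum>b\<in>UNIV. if b = k then (if a < k then \<omega> [a, k] 0 * x $ a else 0) else 0)
      = (\<Sum>a\<in>UNIV. if a < k then \<omega> [a, k] 0 * x $ a else 0)"
    by simp
  finally show ?thesis
    unfolding sum.distrib[symmetric]
    by (auto simp: koszul_matrix_def intro!: sum.cong)
qed

text \<open>Taking signs entrywise keeps the matrix of the Koszul image skew, as \<open>sgn\<close>
  is odd.\<close>

lemma transpose_Phi_koszul: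
  assumes "\<omega> \<in> HForms 0 2"
  shows "transpose (Phi (koszul \<omega>)) = - Phi (koszul \<omega>)"
proof -
  have "coeff_matrix (koszul \<omega>) = koszul_matrix \<omega>"
    by (intro coeff_matrix_eq koszul_HForms_0_2 assms)
  then show ?thesis
    by (auto simp: Phi_def koszul_matrix_def transpose_def vec_eq_iff sgn_minus)
qed

text \<open>The summand in \<open>PForms 0 1\<close> gives the constant \<open>c\<close>, and the
  Koszul summand gives the skew matrix \<open>A\<close>.\<close>

lemma P1minus_1_vector_proxy:
  assumes "\<theta> \<in> P1minus 1"
  obtains c A where "transpose A = - A" "vector_proxy \<theta> = (\<lambda>x. c + A *v x)"
proof -
  obtain \<alpha> \<beta> where \<theta>: "\<theta> = \<alpha> + koszul \<beta>" and \<alpha>: "\<alpha> \<in> PForms 0 1" and \<beta>: "\<beta> \<in> HForms 0 2"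
    using assms by (auto simp: P1minus_def numeral_2_eq_2)
  have "\<alpha> [i] \<in> hom_poly 0" for i
    using \<alpha>[unfolded PForms_def forms_with_def, simplified, THEN spec, of "[i]"]
    by (simp add: poly_le_0_eq_hom_poly_0)
  then have "\<exists>c. \<forall>i. \<alpha> [i] = (\<lambda>x. c i)"
    by (intro choice allI hom_poly_0_const)
  then obtain c where c: "\<And>i. \<alpha> [i] = (\<lambda>x. c i)" by auto
  have "vector_proxy \<theta> = (\<lambda>x. (\<chi> i. c i) + koszul_matrix \<beta> *v x)"
    by (simp add: fun_eq_iff vec_eq_iff vector_proxy_def \<theta> c koszul_HForms_0_2[OF \<beta>]
        matrix_vector_mult_def)
  then show thesis
    using that transpose_koszul_matrix by blast
qed

theorem theorem4p6:
  fixes M :: "(real ^ ('n::{finite,linorder})) set"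
    and I :: "'i::linorder set"
    and v :: "'i \<Rightarrow> real ^ ('n::{finite,linorder})"
    and lam :: "'i \<Rightarrow> real ^ ('n::{finite,linorder}) \<Rightarrow> real"
  assumes "CARD('n) \<ge> 2"
    and "polytope M"
    and "aff_dim M = int CARD('n)"
    and "finite I"
    and "bij_betw v I {p. p extreme_point_of M}"
    and "bary_coords M I v lam"
  shows "(\<forall>x\<in>diff_points M I lam.
            (\<Sum>(i, j) | i \<in> I \<and> j \<in> I \<and> i < j.
               columnvector (whitney M lam i j x) ** (rowvector (v j - v i) :: real ^ ('n::{finite,linorder}) ^ 1))
            = mat 1)
       \<and> (\<forall>\<omega>\<in>HForms 0 2. \<forall>x\<in>diff_points M I lam.
            (\<Sum>(i, j) | i \<in> I \<and> j \<in> I \<and> i < j.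
               ((Phi (koszul \<omega>) *v v i) \<bullet> v j) *\<^sub>R whitney M lam i j x)
            = Phi (koszul \<omega>) *v x)
       \<and> (\<lambda>\<omega>. restr (diff_points M I lam) (vector_proxy \<omega>)) ` P1minus 1
            \<subseteq> fun_span {restr (diff_points M I lam) (whitney M lam i j) | i j. i \<in> I \<and> j \<in> I}"
proof (intro conjI ballI)
  have M: "convex M" "interior M \<noteq> {}"
  proof -
    show "convex M" using assms by (simp add: polytope_imp_convex)
    moreover have "M \<noteq> {}" using assms by auto
    ultimately have "rel_interior M \<noteq> {}" by (simp add: rel_interior_eq_empty)
    \<comment> \<open>Full affine dimension makes the interior equal to the relative
      interior.\<close>
    then show "interior M \<noteq> {}" using assms by (simp add: interior_rel_interior)
  qed
  note hyps = M \<open>finite I\<close> \<open>bary_coords M I v lam\<close>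
  {
    fix x assume x: "x \<in> diff_points M I lam"
    let ?T = "\<lambda>i j. columnvector (whitney M lam i j x) ** (rowvector (v j - v i) :: real ^ ('n::{finite,linorder}) ^ 1)"
    have "(\<Sum>(i, j) | i \<in> I \<and> j \<in> I \<and> i < j. ?T i j) $ k $ l = mat 1 $ k $ l" for k l
    proof -
      \<comment> \<open>Column \<open>l\<close> of the matrix sum is the constant-field identity for
        the unit vector \<open>axis l 1\<close>.\<close>
      have "(\<Sum>(i, j) | i \<in> I \<and> j \<in> I \<and> i < j. ?T i j) $ k $ l
          = (\<Sum>(i, j) | i \<in> I \<and> j \<in> I \<and> i < j. (axis l 1 \<bullet> (v j - v i)) *\<^sub>R whitney M lam i j x) $ k"
        by (simp add: case_prod_unfold matrix_matrix_mult_def columnvector_def rowvector_def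
            inner_axis' mult.commute)
      also have "\<dots> = axis l 1 $ k"
        by (simp only: whitney_const[OF hyps x])
      finally show ?thesis by (simp add: axis_def mat_def)
    qed
    then show "(\<Sum>(i, j) | i \<in> I \<and> j \<in> I \<and> i < j. ?T i j) = mat 1"
      by (simp add: vec_eq_iff)
  }
  show "(\<Sum>(i, j) | i \<in> I \<and> j \<in> I \<and> i < j.
        ((Phi (koszul \<omega>) *v v i) \<bullet> v j) *\<^sub>R whitney M lam i j x) = Phi (koszul \<omega>) *v x"
    if "\<omega> \<in> HForms 0 2" "x \<in> diff_points M I lam" for \<omega> x
    by (intro whitney_linear_skew hyps transpose_Phi_koszul that)
  show "(\<lambda>\<omega>. restr (diff_points M I lam) (vector_proxy \<omega>)) ` P1minus 1
      \<subseteq> fun_span {restr (diff_points M I lam) (whitney M lam i j) | i j. i \<in> I \<and> j \<in> I}"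
  proof (rule image_subsetI)
    fix \<theta> :: "'n dform" assume "\<theta> \<in> P1minus 1"
    then obtain c A where "transpose A = - A" "vector_proxy \<theta> = (\<lambda>x. c + A *v x)"
      by (rule P1minus_1_vector_proxy)
    then show "restr (diff_points M I lam) (vector_proxy \<theta>)
        \<in> fun_span {restr (diff_points M I lam) (whitney M lam i j) | i j. i \<in> I \<and> j \<in> I}"
      using affine_skew_in_span_whitney[OF hyps] by simp
  qed
qed

end
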